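(* Fix $d\in\mathbb N$. Then there is a constant $C$ such that for every $d$-tuple of contractions $A_1,\dots,A_d$ on a Hilbert space $H$ there exist a Hilbert space $K$ of dimension at most $2^{2d-1}\cdot\dim H$, an isometry $V:H\to K$, and $d$ commuting normal operators $T_1,\dots,T_d$ on $K$ satisfying $\|T_i\|\le C$ for $i=1,\dots,d$ such that $$A_i=V^*T_iV,\qquad i=1,\dots,d.$$ One may choose the constant $C=2\sqrt2\,d$. If the $A_j$ are self-adjoint, then one may choose $C=d$, and $T$ can be taken to be a tuple of (commuting) self-adjoint operators acting on a Hilbert space of dimension $2^{d-1}\cdot\dim H$.
   Context: Hilbert spaces are complex; a contraction is an operator of norm at most $1$. *)

theory Defs
  imports
    "HOL-Analysis.Analysis"
    "HOL-Algebra.Algebraic_Closure_Type"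
    "HOL-Library.Equipollence"
begin

section \<open>Complex Hilbert spaces with explicit carrier\<close>

text \<open>
  Hilbert spaces are records, so that one can quantify over them inside a formula. The
  underlying vector space is a module in the sense of HOL-Algebra over the field of complex
  numbers; its (unused) ring fields \<open>mult\<close> and \<open>one\<close> are arbitrary.
  The inner product is linear in the first argument.
\<close>

abbreviation complex_field :: "complex ring" where
  "complex_field \<equiv> ring_of_type_algebra"

record 'a hilbert = "(complex, 'a) module" +
  cinner :: "'a \<Rightarrow> 'a \<Rightarrow> complex"

definition hnorm :: "'a hilbert \<Rightarrow> 'a \<Rightarrow> real" where
  "hnorm H x = sqrt (Re (cinner H x x))"

definition hdist :: "'a hilbert \<Rightarrow> 'a \<Rightarrow> 'a \<Rightarrow> real" where
  "hdist H x y = hnorm H (x \<ominus>\<^bsub>H\<^esub> y)"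

locale complex_inner_space = Module.module complex_field H for H :: "'a hilbert" (structure) +
  assumes cinner_add_left:
      "\<lbrakk>x \<in> carrier H; y \<in> carrier H; z \<in> carrier H\<rbrakk>
        \<Longrightarrow> cinner H (x \<oplus> y) z = cinner H x z + cinner H y z"
    and cinner_smult_left:
      "\<lbrakk>x \<in> carrier H; y \<in> carrier H\<rbrakk> \<Longrightarrow> cinner H (c \<odot> x) y = c * cinner H x y"
    and cinner_commute:
      "\<lbrakk>x \<in> carrier H; y \<in> carrier H\<rbrakk> \<Longrightarrow> cinner H y x = cnj (cinner H x y)"
    and cinner_ge_zero: "x \<in> carrier H \<Longrightarrow> 0 \<le> Re (cinner H x x)"
    and cinner_eq_zero: "\<lbrakk>x \<in> carrier H; cinner H x x = 0\<rbrakk> \<Longrightarrow> x = \<zero>"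

locale hilbert_space = complex_inner_space +
  assumes complete:
    "\<lbrakk>range s \<subseteq> carrier H; \<forall>e>0. \<exists>N. \<forall>m\<ge>N. \<forall>n\<ge>N. hdist H (s m) (s n) < e\<rbrakk>
      \<Longrightarrow> \<exists>l\<in>carrier H. (\<lambda>n. hdist H (s n) l) \<longlonglongrightarrow> 0"


section \<open>Hilbert dimension\<close>

definition orthonormal :: "'a hilbert \<Rightarrow> 'a set \<Rightarrow> bool" where
  "orthonormal H E \<longleftrightarrow>
     E \<subseteq> carrier H \<and> (\<forall>x\<in>E. \<forall>y\<in>E. cinner H x y = (if x = y then 1 else 0))"

definition orthonormal_basis :: "'a hilbert \<Rightarrow> 'a set \<Rightarrow> bool" where
  "orthonormal_basis H E \<longleftrightarrow>
     orthonormal H E \<and> (\<forall>F. orthonormal H F \<and> E \<subseteq> F \<longrightarrow> F = E)"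

text \<open>
  The dimension of a Hilbert space is the cardinality, possibly infinite, of an orthonormal
  basis, and does not depend on the basis. The following say
  \<open>dim K \<le> n \<cdot> dim H\<close> and \<open>dim K = n \<cdot> dim H\<close>.
\<close>

definition dim_le_times :: "'k hilbert \<Rightarrow> nat \<Rightarrow> 'a hilbert \<Rightarrow> bool" where
  "dim_le_times K n H \<longleftrightarrow>
     (\<exists>B E. orthonormal_basis K B \<and> orthonormal_basis H E \<and> B \<lesssim> {..<n} \<times> E)"

definition dim_eq_times :: "'k hilbert \<Rightarrow> nat \<Rightarrow> 'a hilbert \<Rightarrow> bool" where
  "dim_eq_times K n H \<longleftrightarrow>
     (\<exists>B E. orthonormal_basis K B \<and> orthonormal_basis H E \<and> B \<approx> {..<n} \<times> E)"


section \<open>Operators\<close>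

text \<open>
  Operators are HOL functions of which only the values on the carrier matter. The operator
  norm follows \<^const>\<open>onorm\<close>.
\<close>

definition linear_map :: "'a hilbert \<Rightarrow> 'b hilbert \<Rightarrow> ('a \<Rightarrow> 'b) \<Rightarrow> bool" where
  "linear_map H K T \<longleftrightarrow>
     (\<forall>x\<in>carrier H. T x \<in> carrier K) \<and>
     (\<forall>x\<in>carrier H. \<forall>y\<in>carrier H. T (x \<oplus>\<^bsub>H\<^esub> y) = T x \<oplus>\<^bsub>K\<^esub> T y) \<and>
     (\<forall>c. \<forall>x\<in>carrier H. T (c \<odot>\<^bsub>H\<^esub> x) = c \<odot>\<^bsub>K\<^esub> T x)"

definition bounded_operator :: "'a hilbert \<Rightarrow> 'b hilbert \<Rightarrow> ('a \<Rightarrow> 'b) \<Rightarrow> bool" where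
  "bounded_operator H K T \<longleftrightarrow>
     linear_map H K T \<and> (\<exists>M. \<forall>x\<in>carrier H. hnorm K (T x) \<le> M * hnorm H x)"

definition op_norm :: "'a hilbert \<Rightarrow> 'b hilbert \<Rightarrow> ('a \<Rightarrow> 'b) \<Rightarrow> real" where
  "op_norm H K T = (SUP x\<in>carrier H. hnorm K (T x) / hnorm H x)"

definition contraction :: "'a hilbert \<Rightarrow> ('a \<Rightarrow> 'a) \<Rightarrow> bool" where
  "contraction H A \<longleftrightarrow> bounded_operator H H A \<and> op_norm H H A \<le> 1"

definition isometry :: "'a hilbert \<Rightarrow> 'b hilbert \<Rightarrow> ('a \<Rightarrow> 'b) \<Rightarrow> bool" where
  "isometry H K V \<longleftrightarrow> linear_map H K V \<and> (\<forall>x\<in>carrier H. hnorm K (V x) = hnorm H x)"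

definition adj :: "'a hilbert \<Rightarrow> 'b hilbert \<Rightarrow> ('a \<Rightarrow> 'b) \<Rightarrow> 'b \<Rightarrow> 'a" where
  "adj H K T y =
     (THE x. x \<in> carrier H \<and> (\<forall>z\<in>carrier H. cinner H z x = cinner K (T z) y))"

definition normal_operator :: "'a hilbert \<Rightarrow> ('a \<Rightarrow> 'a) \<Rightarrow> bool" where
  "normal_operator H T \<longleftrightarrow>
     bounded_operator H H T \<and> (\<forall>x\<in>carrier H. adj H H T (T x) = T (adj H H T x))"

definition selfadjoint_operator :: "'a hilbert \<Rightarrow> ('a \<Rightarrow> 'a) \<Rightarrow> bool" where
  "selfadjoint_operator H T \<longleftrightarrow>
     bounded_operator H H T \<and> (\<forall>x\<in>carrier H. adj H H T x = T x)"

definition commuting_family :: "'a hilbert \<Rightarrow> 'i set \<Rightarrow> ('i \<Rightarrow> 'a \<Rightarrow> 'a) \<Rightarrow> bool" where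
  "commuting_family H I T \<longleftrightarrow>
     (\<forall>i\<in>I. \<forall>j\<in>I. \<forall>x\<in>carrier H. T i (T j x) = T j (T i x))"

text \<open>\<open>A = V\<^sup>* T V\<close>\<close>

definition compression_eq ::
    "'a hilbert \<Rightarrow> 'b hilbert \<Rightarrow> ('a \<Rightarrow> 'b) \<Rightarrow> ('b \<Rightarrow> 'b) \<Rightarrow> ('a \<Rightarrow> 'a) \<Rightarrow> bool" where
  "compression_eq H K V T A \<longleftrightarrow> (\<forall>x\<in>carrier H. A x = adj H K V (T (V x)))"


section \<open>Commuting dilations\<close>

text \<open>
  The existential quantifier over the space \<open>K\<close> needs a fixed type of vectors. The type
  \<^typ>\<open>nat \<Rightarrow> 'a\<close> loses nothing: a Hilbert space whose dimension is at most a finite multiple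
  of that of \<open>H\<close> is isomorphic to a subspace of a finite direct sum of copies of \<open>H\<close>.
\<close>

definition has_normal_dilation ::
    "nat \<Rightarrow> 'a hilbert \<Rightarrow> (nat \<Rightarrow> 'a \<Rightarrow> 'a) \<Rightarrow> real \<Rightarrow> bool" where
  "has_normal_dilation d H A C \<longleftrightarrow>
     (\<exists>(K :: (nat \<Rightarrow> 'a) hilbert) V T.
        hilbert_space K \<and> dim_le_times K (2 ^ (2 * d - 1)) H \<and> isometry H K V \<and>
        commuting_family K {1..d} T \<and>
        (\<forall>i\<in>{1..d}. normal_operator K (T i) \<and> op_norm K K (T i) \<le> C \<and>
                    compression_eq H K V (T i) (A i)))"

definition has_selfadjoint_dilation ::
    "nat \<Rightarrow> 'a hilbert \<Rightarrow> (nat \<Rightarrow> 'a \<Rightarrow> 'a) \<Rightarrow> real \<Rightarrow> bool" where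
  "has_selfadjoint_dilation d H A C \<longleftrightarrow>
     (\<exists>(K :: (nat \<Rightarrow> 'a) hilbert) V T.
        hilbert_space K \<and> dim_eq_times K (2 ^ (d - 1)) H \<and> isometry H K V \<and>
        commuting_family K {1..d} T \<and>
        (\<forall>i\<in>{1..d}. selfadjoint_operator K (T i) \<and> op_norm K K (T i) \<le> C \<and>
                    compression_eq H K V (T i) (A i)))"

end

(*
  Take K = H^n with n = 2^(d-1) (self-adjoint case) or n = 2^(2d-1) (general case), and let V h
  have m equal components h / sqrt m followed by zeros, where m = d respectively m = 2d; m <= n.
  For a block diagonal operator T with blocks B_j, the compression V^* T V is the average of the
  first m blocks. So in the self-adjoint case T_i has the block d A_i in slot i and zeros
  elsewhere; in the general case two slots carry the normal blocks d (A_i + A_i^* ) and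
  d (A_i - A_i^* ), whose average over the m slots is A_i and whose norms are at most 2d.
  Different T_i live on disjoint slots, hence commute. As 2d <= 2 sqrt 2 d, this is even better
  than the claimed constant.
*)
theory Submission
  imports Defs
begin

section \<open>Inner product spaces\<close>

text \<open>Giving each \<open>A i\<close> slots of its own makes commutation easy; the price is the
  norm. A single slot has weight 1/m in the average, so a block must be scaled by m to survive the
  compression: hence the constant d in the self-adjoint case. A general \<open>A i\<close> cannot
  fill a slot, as the block has to be normal. Its halves (A + A')/2 and (A - A')/2, with A' the
  adjoint, are normal of norm at most 1; each takes a slot of weight 1/(2d), and scaling by 2d gives
  the blocks and the bound 2d. The padding by zeros lets the self-adjoint dilation have dimension
  exactly \<open>2 ^ (d - 1)\<close> times that of \<open>H\<close>.

  The obstacle is \<open>adj\<close>, a definite description that says nothing until a representing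
  vector is known to exist. For the adjoint of \<open>A i\<close> this uses completeness of
  \<open>H\<close>, through the Riesz theorem. On the direct sum the adjoints are guessed and
  verified: the adjoint of a block operator has the adjoint blocks, and the value of the compression
  at \<open>x\<close> is \<open>A i x\<close>.\<close>

lemma complex_field_simps [simp]:
  "carrier complex_field = UNIV"
  "a \<oplus>\<^bsub>complex_field\<^esub> b = a + b"
  "a \<otimes>\<^bsub>complex_field\<^esub> b = a * b"
  "\<one>\<^bsub>complex_field\<^esub> = 1"
  "\<zero>\<^bsub>complex_field\<^esub> = 0"
  by (simp_all add: ring_of_type_algebra_def)

lemma complex_field_uminus [simp]: "\<ominus>\<^bsub>complex_field\<^esub> a = - a"
proof -
  interpret cring complex_field by (rule cring_from_type_algebra)
  show ?thesis by (rule minus_equality) simp_all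
qed

context complex_inner_space
begin

lemma smult_in_carrier [simp, intro]: "x \<in> carrier H \<Longrightarrow> c \<odot> x \<in> carrier H"
  by (rule smult_closed) simp_all

lemma smult_one_left [simp]: "x \<in> carrier H \<Longrightarrow> 1 \<odot> x = x"
  using smult_one by simp

lemma smult_zero_left [simp]: "x \<in> carrier H \<Longrightarrow> 0 \<odot> x = \<zero>"
  using smult_l_null by simp

lemma smult_zero_right [simp]: "c \<odot> \<zero> = \<zero>"
  using smult_r_null[of c] by simp

lemma smult_add_left: "x \<in> carrier H \<Longrightarrow> (a + b) \<odot> x = a \<odot> x \<oplus> b \<odot> x"
  using smult_l_distr[of a b x] by simp

lemma smult_add_right:
  "x \<in> carrier H \<Longrightarrow> y \<in> carrier H \<Longrightarrow> c \<odot> (x \<oplus> y) = c \<odot> x \<oplus> c \<odot> y"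
  using smult_r_distr[of c x y] by simp

lemma smult_smult: "x \<in> carrier H \<Longrightarrow> a \<odot> (b \<odot> x) = (a * b) \<odot> x"
  using smult_assoc1[of a b x] by simp

lemma a_inv_eq_smult: "x \<in> carrier H \<Longrightarrow> \<ominus> x = (- 1) \<odot> x"
  using smult_l_minus[of 1 x] by simp

lemma minus_eq_smult: "x \<in> carrier H \<Longrightarrow> y \<in> carrier H \<Longrightarrow> x \<ominus> y = x \<oplus> (- 1) \<odot> y"
  by (simp add: a_minus_def a_inv_eq_smult)

lemma minus_closed' [simp, intro]: "x \<in> carrier H \<Longrightarrow> y \<in> carrier H \<Longrightarrow> x \<ominus> y \<in> carrier H"
  by (simp add: minus_eq_smult)

lemma cinner_add_right:
  "\<lbrakk>x \<in> carrier H; y \<in> carrier H; z \<in> carrier H\<rbrakk>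
    \<Longrightarrow> cinner H x (y \<oplus> z) = cinner H x y + cinner H x z"
  using cinner_commute[of "y \<oplus> z" x] cinner_commute[of y x] cinner_commute[of z x]
  by (simp add: cinner_add_left)

lemma cinner_smult_right:
  "\<lbrakk>x \<in> carrier H; y \<in> carrier H\<rbrakk> \<Longrightarrow> cinner H x (c \<odot> y) = cnj c * cinner H x y"
  using cinner_commute[of "c \<odot> y" x] cinner_commute[of y x]
  by (simp add: cinner_smult_left)

lemma cinner_minus_left:
  "\<lbrakk>x \<in> carrier H; y \<in> carrier H; z \<in> carrier H\<rbrakk>
    \<Longrightarrow> cinner H (x \<ominus> y) z = cinner H x z - cinner H y z"
  by (simp add: minus_eq_smult cinner_add_left cinner_smult_left)

lemma cinner_minus_right:
  "\<lbrakk>x \<in> carrier H; y \<in> carrier H; z \<in> carrier H\<rbrakk>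
    \<Longrightarrow> cinner H x (y \<ominus> z) = cinner H x y - cinner H x z"
  by (simp add: minus_eq_smult cinner_add_right cinner_smult_right)

lemma cinner_zero_left [simp]: "x \<in> carrier H \<Longrightarrow> cinner H \<zero> x = 0"
  using cinner_smult_left[of \<zero> x 0] by simp

lemma cinner_zero_right [simp]: "x \<in> carrier H \<Longrightarrow> cinner H x \<zero> = 0"
  using cinner_smult_right[of x \<zero> 0] by simp

lemmas cinner_expand = cinner_add_left cinner_add_right cinner_smult_left cinner_smult_right
  cinner_minus_left cinner_minus_right

section \<open>Norm and Cauchy-Schwarz inequality\<close>

lemma Re_cinner_commute:
  "\<lbrakk>x \<in> carrier H; y \<in> carrier H\<rbrakk> \<Longrightarrow> Re (cinner H y x) = Re (cinner H x y)"
  using cinner_commute[of x y] by simp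

lemma hnorm_ge_zero [simp]: "x \<in> carrier H \<Longrightarrow> 0 \<le> hnorm H x"
  by (simp add: hnorm_def cinner_ge_zero)

lemma hnorm_square: "x \<in> carrier H \<Longrightarrow> (hnorm H x)\<^sup>2 = Re (cinner H x x)"
  by (simp add: hnorm_def cinner_ge_zero)

text \<open>Conjugate symmetry makes \<open>cinner H x x\<close> real, so \<open>hnorm\<close>,
  which reads off the real part, loses nothing.\<close>

lemma cinner_self: "x \<in> carrier H \<Longrightarrow> cinner H x x = of_real ((hnorm H x)\<^sup>2)"
  using cinner_commute[of x x] by (simp add: hnorm_square complex_eq_iff)

lemma hnorm_eq_zero [simp]: "x \<in> carrier H \<Longrightarrow> hnorm H x = 0 \<longleftrightarrow> x = \<zero>"
  using cinner_self[of x] cinner_eq_zero[of x] by (auto simp: hnorm_def)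

lemma hnorm_pos: "x \<in> carrier H \<Longrightarrow> x \<noteq> \<zero> \<Longrightarrow> 0 < hnorm H x"
  using hnorm_ge_zero[of x] hnorm_eq_zero[of x] by linarith

lemma hnorm_zero [simp]: "hnorm H \<zero> = 0"
  by simp

lemma hnorm_smult: "x \<in> carrier H \<Longrightarrow> hnorm H (c \<odot> x) = cmod c * hnorm H x"
proof -
  assume x: "x \<in> carrier H"
  have "cinner H (c \<odot> x) (c \<odot> x) = (c * cnj c) * of_real ((hnorm H x)\<^sup>2)"
    using x by (simp only: smult_in_carrier cinner_smult_left cinner_smult_right cinner_self[OF x] mult_ac)
  also have "\<dots> = of_real ((cmod c)\<^sup>2 * (hnorm H x)\<^sup>2)"
    by (simp add: complex_norm_square[symmetric])
  finally have "Re (cinner H (c \<odot> x) (c \<odot> x)) = (cmod c)\<^sup>2 * (hnorm H x)\<^sup>2"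
    by (simp only: Re_complex_of_real)
  then have "(hnorm H (c \<odot> x))\<^sup>2 = (cmod c * hnorm H x)\<^sup>2"
    using x by (simp add: hnorm_square power_mult_distrib)
  then show ?thesis
    using x by (simp add: power2_eq_iff_nonneg)
qed

lemma hnorm_add_square:
  assumes "x \<in> carrier H" "y \<in> carrier H"
  shows "(hnorm H (x \<oplus> y))\<^sup>2 = (hnorm H x)\<^sup>2 + (hnorm H y)\<^sup>2 + 2 * Re (cinner H x y)"
  using assms Re_cinner_commute[of x y] by (simp add: hnorm_square cinner_expand)

lemma hnorm_minus_square:
  assumes "x \<in> carrier H" "y \<in> carrier H"
  shows "(hnorm H (x \<ominus> y))\<^sup>2 = (hnorm H x)\<^sup>2 + (hnorm H y)\<^sup>2 - 2 * Re (cinner H x y)"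
  using assms Re_cinner_commute[of x y] by (simp add: hnorm_square cinner_expand)

lemma Cauchy_Schwarz:
  assumes x: "x \<in> carrier H" and y: "y \<in> carrier H"
  shows "cmod (cinner H x y) \<le> hnorm H x * hnorm H y"
proof (cases "y = \<zero>")
  case True
  then show ?thesis using x by simp
next
  case False
  then have pos: "0 < hnorm H y"
    using y by (simp add: hnorm_pos)
  \<comment> \<open>\<open>c \<odot> y\<close> is the orthogonal projection of \<open>x\<close> onto
    the line through \<open>y\<close>; the inequality says that the residual has nonnegative square
    norm.\<close>
  define c where "c = cinner H x y / of_real ((hnorm H y)\<^sup>2)"
  have cmod_c: "cmod c * (hnorm H y)\<^sup>2 = cmod (cinner H x y)"
    using pos by (simp add: c_def norm_divide norm_power)
  have "cinner H x y = c * of_real ((hnorm H y)\<^sup>2)"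
    using pos by (simp add: c_def)
  then have "cnj c * cinner H x y = (c * cnj c) * of_real ((hnorm H y)\<^sup>2)"
    by (simp only: mult_ac)
  also have "\<dots> = of_real ((cmod c)\<^sup>2 * (hnorm H y)\<^sup>2)"
    by (simp add: complex_norm_square[symmetric])
  finally have "Re (cnj c * cinner H x y) = (cmod c)\<^sup>2 * (hnorm H y)\<^sup>2"
    by (simp only: Re_complex_of_real)
  then have re: "Re (cinner H x (c \<odot> y)) = (cmod c)\<^sup>2 * (hnorm H y)\<^sup>2"
    using x y by (simp only: cinner_smult_right)
  have "0 \<le> (hnorm H (x \<ominus> c \<odot> y))\<^sup>2" by simp
  also have "\<dots> = (hnorm H x)\<^sup>2 - (cmod c)\<^sup>2 * (hnorm H y)\<^sup>2"
    using x y re by (simp add: hnorm_minus_square hnorm_smult power_mult_distrib)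
  finally have "(cmod c * hnorm H y)\<^sup>2 \<le> (hnorm H x)\<^sup>2"
    by (simp add: power_mult_distrib)
  then have "cmod c * hnorm H y \<le> hnorm H x"
    using x by (rule power2_le_imp_le[OF _ hnorm_ge_zero])
  then have "cmod c * hnorm H y * hnorm H y \<le> hnorm H x * hnorm H y"
    using pos by (simp add: mult_right_mono)
  then show ?thesis using cmod_c by (simp add: power2_eq_square mult.assoc)
qed

lemma hnorm_triangle:
  assumes x: "x \<in> carrier H" and y: "y \<in> carrier H"
  shows "hnorm H (x \<oplus> y) \<le> hnorm H x + hnorm H y"
proof (rule power2_le_imp_le)
  have "Re (cinner H x y) \<le> hnorm H x * hnorm H y"
    using Cauchy_Schwarz[OF x y] complex_Re_le_cmod[of "cinner H x y"] by linarith
  then show "(hnorm H (x \<oplus> y))\<^sup>2 \<le> (hnorm H x + hnorm H y)\<^sup>2"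
    using x y by (simp add: hnorm_add_square power2_sum)
qed (simp add: x y)

text \<open>Tested at \<open>z = x \<ominus> y\<close>. It gives uniqueness in the definite
  description \<open>adj\<close> and linearity of operators that have an adjoint.\<close>

lemma eq_if_cinner_eq:
  assumes x: "x \<in> carrier H" and y: "y \<in> carrier H"
    and eq: "\<And>z. z \<in> carrier H \<Longrightarrow> cinner H z x = cinner H z y"
  shows "x = y"
proof -
  have "cinner H (x \<ominus> y) (x \<ominus> y) = 0"
    using eq[of "x \<ominus> y"] x y by (simp add: cinner_minus_right)
  then have "x \<ominus> y = \<zero>" using x y by (intro cinner_eq_zero) simp_all
  then have "\<ominus> (\<ominus> y) = x" using x y by (intro M.minus_equality) (simp_all add: a_minus_def)
  then show ?thesis using y by simp
qed

section \<open>Orthonormal bases\<close>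

text \<open>Zorn's lemma: orthonormality concerns two vectors at a time, and two vectors in the
  union of a chain already lie in one member.\<close>

lemma orthonormal_basis_exists: "\<exists>E. orthonormal_basis H E"
proof -
  have "\<exists>M\<in>Collect (orthonormal H). \<forall>P\<in>Collect (orthonormal H). M \<subseteq> P \<longrightarrow> P = M"
  proof (rule subset_Zorn')
    fix C assume C: "subset.chain (Collect (orthonormal H)) C"
    have "cinner H x y = (if x = y then 1 else 0)" if xy: "x \<in> \<Union>C" "y \<in> \<Union>C" for x y
    proof -
      obtain P Q where "P \<in> C" "Q \<in> C" "x \<in> P" "y \<in> Q" using xy by blast
      with C obtain R where "R \<in> C" "x \<in> R" "y \<in> R"
        unfolding subset_chain_def by blast
      with C show ?thesis unfolding subset_chain_def orthonormal_def by blast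
    qed
    with C show "\<Union>C \<in> Collect (orthonormal H)"
      unfolding subset_chain_def orthonormal_def by blast
  qed
  then show ?thesis unfolding orthonormal_basis_def by blast
qed

text \<open>If \<open>x\<close> were nonzero, its normalisation could be adjoined to
  \<open>E\<close>, against maximality.\<close>

lemma orthonormal_basis_orthogonal:
  assumes E: "orthonormal_basis H E" and x: "x \<in> carrier H"
    and orth: "\<And>e. e \<in> E \<Longrightarrow> cinner H x e = 0"
  shows "x = \<zero>"
proof (rule ccontr)
  assume "x \<noteq> \<zero>"
  then have n: "hnorm H x \<noteq> 0" using x by simp
  define u where "u = of_real (1 / hnorm H x) \<odot> x"
  have u: "u \<in> carrier H" using x by (simp add: u_def)
  have uu: "cinner H u u = 1"
    using n x by (simp add: u_def cinner_expand cinner_self[OF x] power2_eq_square)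
  have ue: "cinner H u e = 0" "cinner H e u = 0" if "e \<in> E" for e
  proof -
    have e: "e \<in> carrier H" using E that by (auto simp: orthonormal_basis_def orthonormal_def)
    show "cinner H u e = 0" using orth[OF that] x e by (simp add: u_def cinner_smult_left)
    then show "cinner H e u = 0" using cinner_commute[OF u e] by simp
  qed
  have "orthonormal H (insert u E)"
    using E u uu ue unfolding orthonormal_basis_def orthonormal_def by auto
  then have "u \<in> E" using E unfolding orthonormal_basis_def by blast
  then show False using ue uu by fastforce
qed

section \<open>Operator norm, computation of adjoints, and a criterion for bases\<close>

text \<open>A real supremum bounds its terms only if the quotients are bounded above, which comes
  from \<open>bounded_operator\<close>. The zero vector is separate: its quotient 0/0 = 0 carries no
  information.\<close>

lemma contraction_hnorm_le:
  assumes "contraction H A" "x \<in> carrier H"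
  shows "hnorm H (A x) \<le> hnorm H x"
proof (cases "x = \<zero>")
  case True
  obtain M where "hnorm H (A x) \<le> M * hnorm H x"
    using assms unfolding contraction_def bounded_operator_def by blast
  with True show ?thesis by simp
next
  case False
  then have pos: "0 < hnorm H x"
    using assms by (simp add: hnorm_pos)
  obtain M where M: "\<And>x. x \<in> carrier H \<Longrightarrow> hnorm H (A x) \<le> M * hnorm H x"
    using assms unfolding contraction_def bounded_operator_def by blast
  \<comment> \<open>The absolute value is there because \<open>M\<close> may be negative on the zero
    space; at \<open>hnorm H y = 0\<close> the quotient is 0 by convention.\<close>
  have "hnorm H (A y) / hnorm H y \<le> \<bar>M\<bar>" if "y \<in> carrier H" for y
  proof (cases "hnorm H y = 0")
    case False
    then have "0 < hnorm H y" using that hnorm_ge_zero[of y] by linarith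
    then show ?thesis using M[OF that]
      by (simp add: divide_simps) (meson abs_ge_self mult_right_mono order_trans less_imp_le)
  qed simp
  then have "bdd_above ((\<lambda>y. hnorm H (A y) / hnorm H y) ` carrier H)"
    by (auto intro!: bdd_aboveI)
  then have "hnorm H (A x) / hnorm H x \<le> op_norm H H A"
    unfolding op_norm_def using assms by (intro cSUP_upper) auto
  also have "\<dots> \<le> 1" using assms by (simp add: contraction_def)
  finally show ?thesis using pos by (simp add: divide_simps)
qed

lemma op_norm_le:
  assumes "\<And>x. x \<in> carrier H \<Longrightarrow> hnorm H (T x) \<le> M * hnorm H x" "0 \<le> M"
  shows "op_norm H H T \<le> M"
  unfolding op_norm_def
proof (rule cSUP_least)
  show "carrier H \<noteq> {}" by blast
  fix x assume x: "x \<in> carrier H"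
  then have "0 \<le> hnorm H x" by simp
  then show "hnorm H (T x) / hnorm H x \<le> M"
    using assms(1)[OF x] assms(2) by (cases "hnorm H x = 0") (auto simp: divide_simps)
qed

text \<open>Reduces computing an adjoint to guessing its value: any vector that satisfies the
  defining equation is the one selected by \<open>THE\<close>.\<close>

lemma adj_eqI:
  assumes "x \<in> carrier H" "\<And>z. z \<in> carrier H \<Longrightarrow> cinner H z x = cinner K (T z) y"
  shows "adj H K T y = x"
  unfolding adj_def using assms by (intro the_equality) (auto intro!: eq_if_cinner_eq)

text \<open>A vector of a larger orthonormal set outside \<open>E\<close> would be orthogonal to
  \<open>E\<close>, hence zero, yet of norm 1.\<close>

lemma orthonormal_basisI:
  assumes E: "orthonormal H E"
    and total: "\<And>x. \<lbrakk>x \<in> carrier H; \<And>e. e \<in> E \<Longrightarrow> cinner H x e = 0\<rbrakk> \<Longrightarrow> x = \<zero>"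
  shows "orthonormal_basis H E"
  unfolding orthonormal_basis_def
proof (intro conjI allI impI E)
  fix F assume F: "orthonormal H F \<and> E \<subseteq> F"
  have "f \<in> E" if f: "f \<in> F" for f
  proof (rule ccontr)
    assume "f \<notin> E"
    moreover have fc: "f \<in> carrier H" using F f unfolding orthonormal_def by blast
    ultimately have "f = \<zero>"
      using F f unfolding orthonormal_def by (intro total) auto
    moreover have "cinner H f f = 1" using F f unfolding orthonormal_def by simp
    ultimately show False by simp
  qed
  then show "F = E" using F by blast
qed

end


section \<open>Adjoints\<close>

context hilbert_space
begin

text \<open>
  The representing vector minimises \<open>F x = \<parallel>x\<parallel>\<^sup>2 - 2 Re (\<phi> x)\<close>; this avoids
  orthogonal projections onto the kernel of \<open>\<phi>\<close>.
\<close>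

lemma Riesz_representation:
  assumes add: "\<And>x y. \<lbrakk>x \<in> carrier H; y \<in> carrier H\<rbrakk> \<Longrightarrow> \<phi> (x \<oplus> y) = \<phi> x + \<phi> y"
    and smult: "\<And>c x. x \<in> carrier H \<Longrightarrow> \<phi> (c \<odot> x) = c * \<phi> x"
    and bound: "\<And>x. x \<in> carrier H \<Longrightarrow> cmod (\<phi> x) \<le> M * hnorm H x"
  shows "\<exists>l\<in>carrier H. \<forall>x\<in>carrier H. \<phi> x = cinner H x l"
proof -
  define F where "F x = (hnorm H x)\<^sup>2 - 2 * Re (\<phi> x)" for x
  define m where "m = Inf (F ` carrier H)"
  \<comment> \<open>Completing the square: \<open>F x\<close> is at least
    \<open>(hnorm H x - M)\<^sup>2 - M\<^sup>2\<close>.\<close>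
  have "- M\<^sup>2 \<le> F x" if x: "x \<in> carrier H" for x
  proof -
    have "Re (\<phi> x) \<le> M * hnorm H x"
      using bound[OF x] complex_Re_le_cmod[of "\<phi> x"] by linarith
    moreover have "0 \<le> (hnorm H x - M)\<^sup>2" by simp
    ultimately show ?thesis by (simp add: F_def power2_diff mult.commute)
  qed
  then have bdd: "bdd_below (F ` carrier H)" by (rule bdd_belowI2)
  have m_le: "m \<le> F x" if "x \<in> carrier H" for x
    unfolding m_def using bdd that by (intro cINF_lower)
  have "\<exists>x\<in>carrier H. F x < m + 1 / Suc n" for n
  proof -
    have ne: "carrier H \<noteq> {}" by blast
    have "Inf (F ` carrier H) < m + 1 / Suc n" by (simp add: m_def)
    then show ?thesis using cINF_less_iff[OF ne bdd] by blast
  qed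
  then obtain s where s: "\<And>n. s n \<in> carrier H" and F_s: "\<And>n. F (s n) < m + 1 / Suc n"
    by metis
  \<comment> \<open>Parallelogram law; the linear part of \<open>F\<close> averages out. As
    \<open>F\<close> is at least \<open>m\<close> at the midpoint, two near-minimisers are close
    together.\<close>
  have parallelogram: "(hdist H x y)\<^sup>2 + 4 * F ((1/2) \<odot> (x \<oplus> y)) = 2 * F x + 2 * F y"
    if x: "x \<in> carrier H" and y: "y \<in> carrier H" for x y
  proof -
    have "(hnorm H ((1/2) \<odot> (x \<oplus> y)))\<^sup>2 = (hnorm H (x \<oplus> y))\<^sup>2 / 4"
      using x y by (simp add: hnorm_smult norm_divide power_divide)
    moreover have "Re (\<phi> ((1/2) \<odot> (x \<oplus> y))) = (Re (\<phi> x) + Re (\<phi> y)) / 2"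
      using x y by (simp add: add smult)
    ultimately show ?thesis
      unfolding hdist_def F_def hnorm_minus_square[OF x y] hnorm_add_square[OF x y] by argo
  qed
  have dist_le: "(hdist H (s i) (s j))\<^sup>2 \<le> 4 / Suc N" if "N \<le> i" "N \<le> j" for i j N
  proof -
    have "m \<le> F ((1/2) \<odot> (s i \<oplus> s j))" using s by (intro m_le) simp
    moreover have "1 / real (Suc i) \<le> 1 / Suc N" "1 / real (Suc j) \<le> 1 / Suc N"
      using that by (simp_all add: frac_le)
    ultimately show ?thesis
      using parallelogram[OF s[of i] s[of j]] F_s[of i] F_s[of j] by linarith
  qed
  have Cauchy: "\<exists>N. \<forall>i\<ge>N. \<forall>j\<ge>N. hdist H (s i) (s j) < e" if e: "e > 0" for e
  proof -
    have "0 < e\<^sup>2 / 4" using e by simp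
    then obtain N where "inverse (real (Suc N)) < e\<^sup>2 / 4"
      using reals_Archimedean by blast
    moreover have "4 / real (Suc N) = 4 * inverse (real (Suc N))" by (simp only: divide_inverse)
    ultimately have N: "4 / real (Suc N) < e\<^sup>2" by linarith
    have "hdist H (s i) (s j) < e" if "N \<le> i" "N \<le> j" for i j
      using e by (intro power2_less_imp_less[OF order_le_less_trans[OF dist_le[OF that] N]]) simp
    then show ?thesis by (intro exI[of _ N] allI impI)
  qed
  then obtain l where l: "l \<in> carrier H" and lim: "(\<lambda>n. hdist H (s n) l) \<longlonglongrightarrow> 0"
    using complete[of s] s Cauchy by blast
  have cinner_lim: "(\<lambda>n. Re (cinner H x (s n))) \<longlonglongrightarrow> Re (cinner H x l)"
    if x: "x \<in> carrier H" for x
  proof (rule tendsto_Re, rule LIM_zero_cancel, rule Lim_null_comparison)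
    show "\<forall>\<^sub>F n in sequentially.
        cmod (cinner H x (s n) - cinner H x l) \<le> hnorm H x * hdist H (s n) l"
      using Cauchy_Schwarz[OF x minus_closed'[OF s l]] x s l
      by (simp add: hdist_def cinner_minus_right)
    show "(\<lambda>n. hnorm H x * hdist H (s n) l) \<longlonglongrightarrow> 0"
      using tendsto_mult_left[OF lim, of "hnorm H x"] by simp
  qed
  have Re_eq: "Re (\<phi> x) = Re (cinner H x l)" if x: "x \<in> carrier H" for x
  proof -
    \<comment> \<open>\<open>2 * \<delta>\<close> is the derivative of \<open>F\<close> at
      \<open>l\<close> in direction \<open>x\<close>, so it has to vanish.\<close>
    define \<delta> where "\<delta> = Re (cinner H x l) - Re (\<phi> x)"
    \<comment> \<open>Minimality is expressed along \<open>s n\<close> and passed to the limit, in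
      place of a proof that \<open>F l = m\<close>.\<close>
    have quadratic: "0 \<le> 2 * t * \<delta> + t\<^sup>2 * (hnorm H x)\<^sup>2" for t :: real
    proof (rule LIMSEQ_le)
      show "(\<lambda>n. - (1 / real (Suc n))) \<longlonglongrightarrow> 0"
        using tendsto_minus[OF LIMSEQ_inverse_real_of_nat] by (simp add: inverse_eq_divide)
      show "(\<lambda>n. 2 * t * (Re (cinner H x (s n)) - Re (\<phi> x)) + t\<^sup>2 * (hnorm H x)\<^sup>2)
          \<longlonglongrightarrow> 2 * t * \<delta> + t\<^sup>2 * (hnorm H x)\<^sup>2"
        unfolding \<delta>_def by (intro tendsto_intros cinner_lim x)
      have "- (1 / real (Suc n))
          \<le> 2 * t * (Re (cinner H x (s n)) - Re (\<phi> x)) + t\<^sup>2 * (hnorm H x)\<^sup>2" for n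
      proof -
        have "F (s n \<oplus> of_real t \<odot> x)
            = F (s n) + 2 * t * (Re (cinner H x (s n)) - Re (\<phi> x)) + t\<^sup>2 * (hnorm H x)\<^sup>2"
          using s[of n] x Re_cinner_commute[OF x s[of n]] unfolding F_def
          by (simp add: hnorm_add_square hnorm_smult cinner_smult_right add smult
              power_mult_distrib algebra_simps)
        then show ?thesis
          using m_le[of "s n \<oplus> of_real t \<odot> x"] F_s[of n] s[of n] x by simp
      qed
      then show "\<exists>N. \<forall>n\<ge>N. - (1 / real (Suc n))
          \<le> 2 * t * (Re (cinner H x (s n)) - Re (\<phi> x)) + t\<^sup>2 * (hnorm H x)\<^sup>2"
        by blast
    qed
    define N where "N = (hnorm H x)\<^sup>2"
    have N: "0 \<le> N" by (simp add: N_def)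
    \<comment> \<open>For nonzero \<open>x\<close> the quadratic is smallest at
      \<open>- \<delta> / N\<close>. The denominator \<open>N + 1\<close> also covers
      \<open>x = \<zero>\<close>, and the value stays negative unless
      \<open>\<delta> = 0\<close>.\<close>
    define q where "q = - \<delta> / (N + 1)"
    have q: "q * (N + 1) = - \<delta>" using N by (simp add: q_def)
    have "0 \<le> (2 * q * \<delta> + q\<^sup>2 * N) * (N + 1)\<^sup>2"
      using quadratic[of q] by (simp add: N_def)
    also have "\<dots> = 2 * (q * (N + 1)) * \<delta> * (N + 1) + (q * (N + 1))\<^sup>2 * N"
      by (simp add: power2_eq_square algebra_simps)
    also have "\<dots> = - (\<delta>\<^sup>2 * (N + 2))"
      unfolding q by (simp add: power2_eq_square algebra_simps)
    finally have "\<delta>\<^sup>2 * (N + 2) \<le> 0" by simp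
    then have "\<delta>\<^sup>2 \<le> 0" using N by (simp add: mult_le_0_iff)
    then show ?thesis by (simp add: \<delta>_def)
  qed
  have "\<phi> x = cinner H x l" if x: "x \<in> carrier H" for x
    \<comment> \<open>By complex linearity, the real part at \<open>(- \<i>) \<odot> x\<close> is
      the imaginary part at \<open>x\<close>.\<close>
    using Re_eq[OF x] Re_eq[of "(- \<i>) \<odot> x"] x l
    by (simp add: complex_eq_iff smult cinner_smult_left)
  then show ?thesis using l by blast
qed

text \<open>Riesz applied to the functional \<open>cinner K (T x) y\<close> of \<open>x\<close>,
  which is bounded by Cauchy-Schwarz in \<open>K\<close>.\<close>

lemma adj_properties:
  assumes K: "complex_inner_space K" and T: "bounded_operator H K T" and y: "y \<in> carrier K"
  shows adj_in_carrier: "adj H K T y \<in> carrier H"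
    and cinner_adj: "z \<in> carrier H \<Longrightarrow> cinner H z (adj H K T y) = cinner K (T z) y"
proof -
  interpret K: complex_inner_space K by (rule K)
  obtain M where M: "\<And>x. x \<in> carrier H \<Longrightarrow> hnorm K (T x) \<le> M * hnorm H x"
    and lin: "linear_map H K T"
    using T unfolding bounded_operator_def by blast
  have "\<exists>l\<in>carrier H. \<forall>x\<in>carrier H. cinner K (T x) y = cinner H x l"
  proof (rule Riesz_representation)
    fix x assume x: "x \<in> carrier H"
    then have Tx: "T x \<in> carrier K" using lin by (simp add: linear_map_def)
    have "cmod (cinner K (T x) y) \<le> hnorm K (T x) * hnorm K y"
      by (rule K.Cauchy_Schwarz[OF Tx y])
    also have "\<dots> \<le> M * hnorm H x * hnorm K y"
      using M[OF x] y by (intro mult_right_mono) simp_all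
    finally show "cmod (cinner K (T x) y) \<le> (M * hnorm K y) * hnorm H x"
      by (simp only: mult_ac)
  qed (use lin y in \<open>simp_all add: linear_map_def K.cinner_add_left K.cinner_smult_left\<close>)
  then obtain l where l: "l \<in> carrier H" "\<And>x. x \<in> carrier H \<Longrightarrow> cinner H x l = cinner K (T x) y"
    by metis
  then have "adj H K T y = l" by (rule adj_eqI)
  then show "adj H K T y \<in> carrier H"
    and "z \<in> carrier H \<Longrightarrow> cinner H z (adj H K T y) = cinner K (T z) y"
    using l by simp_all
qed

end

section \<open>Pairs of mutually adjoint operators\<close>

text \<open>Keeps the adjoint as an explicit map instead of a definite description, so that adjoints
  of sums, multiples and block operators can be written down directly.\<close>

definition adjoint_pair :: "'a hilbert \<Rightarrow> ('a \<Rightarrow> 'a) \<Rightarrow> ('a \<Rightarrow> 'a) \<Rightarrow> bool" where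
  "adjoint_pair H S S' \<longleftrightarrow>
     (\<forall>x\<in>carrier H. S x \<in> carrier H \<and> S' x \<in> carrier H) \<and>
     (\<forall>x\<in>carrier H. \<forall>y\<in>carrier H. cinner H (S x) y = cinner H x (S' y))"

lemma adjoint_pairD:
  assumes "adjoint_pair H S S'"
  shows "x \<in> carrier H \<Longrightarrow> S x \<in> carrier H" "x \<in> carrier H \<Longrightarrow> S' x \<in> carrier H"
    and "\<lbrakk>x \<in> carrier H; y \<in> carrier H\<rbrakk> \<Longrightarrow> cinner H (S x) y = cinner H x (S' y)"
  using assms by (simp_all add: adjoint_pair_def)

context complex_inner_space
begin

lemma adjoint_pair_swap:
  assumes "adjoint_pair H S S'"
  shows "adjoint_pair H S' S"
proof -
  note S = adjoint_pairD[OF assms]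
  have "cinner H (S' x) y = cinner H x (S y)" if x: "x \<in> carrier H" and y: "y \<in> carrier H" for x y
    using S(3)[OF y x] cinner_commute[OF y S(2)[OF x]] cinner_commute[OF S(1)[OF y] x] by simp
  then show ?thesis using S by (simp add: adjoint_pair_def)
qed

text \<open>Moving \<open>S\<close> across the inner product leaves \<open>S'\<close> on the other
  side, where the identities are those of the inner product itself.\<close>

lemma adjoint_pair_linear:
  assumes "adjoint_pair H S S'"
  shows "linear_map H H S"
proof -
  note S = adjoint_pairD[OF assms] and S' = adjoint_pairD(3)[OF adjoint_pair_swap[OF assms]]
  have "S (x \<oplus> y) = S x \<oplus> S y" if x: "x \<in> carrier H" and y: "y \<in> carrier H" for x y
  proof (rule eq_if_cinner_eq)
    fix z assume z: "z \<in> carrier H"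
    show "cinner H z (S (x \<oplus> y)) = cinner H z (S x \<oplus> S y)"
      using x y z S(1,2) S'[OF z, symmetric] by (simp add: cinner_add_right)
  qed (use x y S(1) in simp_all)
  moreover have "S (c \<odot> x) = c \<odot> S x" if x: "x \<in> carrier H" for c x
  proof (rule eq_if_cinner_eq)
    fix z assume z: "z \<in> carrier H"
    show "cinner H z (S (c \<odot> x)) = cinner H z (c \<odot> S x)"
      using x z S(1,2) S'[OF z, symmetric] by (simp add: cinner_smult_right)
  qed (use x S(1) in simp_all)
  ultimately show ?thesis using S(1) by (simp add: linear_map_def)
qed

lemma adjoint_pair_adj:
  assumes "adjoint_pair H S S'" "y \<in> carrier H"
  shows "adj H H S y = S' y"
  using adjoint_pairD[OF assms(1)] assms(2) by (intro adj_eqI) simp_all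

text \<open>The square of the norm of \<open>S' y\<close> is \<open>cinner H (S (S' y)) y\<close>;
  apply Cauchy-Schwarz and cancel one factor.\<close>

lemma adjoint_pair_bound:
  assumes "adjoint_pair H S S'" and bound: "\<And>x. x \<in> carrier H \<Longrightarrow> hnorm H (S x) \<le> M * hnorm H x"
    and y: "y \<in> carrier H"
  shows "hnorm H (S' y) \<le> M * hnorm H y"
proof (cases "S' y = \<zero>")
  case True
  \<comment> \<open>The sign of \<open>M\<close> is not given; the right side is nonnegative because
    of \<open>bound\<close> itself.\<close>
  have "0 \<le> M * hnorm H y"
    using bound[OF y] hnorm_ge_zero[OF adjoint_pairD(1)[OF assms(1) y]] by linarith
  then show ?thesis using True by simp
next
  case False
  note S = adjoint_pairD[OF assms(1)]
  have pos: "0 < hnorm H (S' y)" using False S(2) y by (simp add: hnorm_pos)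
  have "(hnorm H (S' y))\<^sup>2 = Re (cinner H (S (S' y)) y)"
    using S y by (simp add: hnorm_square)
  also have "\<dots> \<le> hnorm H (S (S' y)) * hnorm H y"
    using Cauchy_Schwarz[of "S (S' y)" y] complex_Re_le_cmod[of "cinner H (S (S' y)) y"] S y by auto
  also have "\<dots> \<le> M * hnorm H (S' y) * hnorm H y"
    using bound S y by (intro mult_right_mono) simp_all
  finally have "hnorm H (S' y) * hnorm H (S' y) \<le> (M * hnorm H y) * hnorm H (S' y)"
    by (simp only: power2_eq_square mult_ac)
  then show ?thesis using pos by simp
qed

lemma adjoint_pair_smult:
  "adjoint_pair H S S' \<Longrightarrow> adjoint_pair H (\<lambda>x. c \<odot> S x) (\<lambda>x. cnj c \<odot> S' x)"
  by (simp add: adjoint_pair_def cinner_smult_left cinner_smult_right)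

lemma adjoint_pair_add:
  "\<lbrakk>adjoint_pair H S S'; adjoint_pair H R R'\<rbrakk>
    \<Longrightarrow> adjoint_pair H (\<lambda>x. S x \<oplus> R x) (\<lambda>x. S' x \<oplus> R' x)"
  by (simp add: adjoint_pair_def cinner_add_left cinner_add_right)

end

lemma (in hilbert_space) adjoint_pair_exists:
  assumes "bounded_operator H H T"
  shows "adjoint_pair H T (adj H H T)"
proof -
  note adj = adj_in_carrier[OF complex_inner_space_axioms assms]
    cinner_adj[OF complex_inner_space_axioms assms]
  have T: "T x \<in> carrier H" if "x \<in> carrier H" for x
    using assms that by (simp add: bounded_operator_def linear_map_def)
  then show ?thesis by (simp add: adjoint_pair_def adj)
qed


section \<open>Finite direct sums of copies of a Hilbert space\<close>

text \<open>An n-tuple is stored as a function that is zero from index \<open>n\<close> on. The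
  padding makes equal tuples equal functions, so the inner product is definite.\<close>

definition hcopies :: "nat \<Rightarrow> 'a hilbert \<Rightarrow> (nat \<Rightarrow> 'a) hilbert" where
  "hcopies n H = \<lparr>
     carrier = {f. (\<forall>j. f j \<in> carrier H) \<and> (\<forall>j\<ge>n. f j = \<zero>\<^bsub>H\<^esub>)},
     monoid.mult = (\<lambda>f g. f), one = (\<lambda>j. \<zero>\<^bsub>H\<^esub>),
     ring.zero = (\<lambda>j. \<zero>\<^bsub>H\<^esub>), add = (\<lambda>f g j. f j \<oplus>\<^bsub>H\<^esub> g j),
     smult = (\<lambda>c f j. c \<odot>\<^bsub>H\<^esub> f j),
     cinner = (\<lambda>f g. \<Sum>j<n. cinner H (f j) (g j))\<rparr>"

lemma hcopies_simps [simp]: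
  "f \<in> carrier (hcopies n H) \<longleftrightarrow> (\<forall>j. f j \<in> carrier H) \<and> (\<forall>j\<ge>n. f j = \<zero>\<^bsub>H\<^esub>)"
  "\<zero>\<^bsub>hcopies n H\<^esub> = (\<lambda>j. \<zero>\<^bsub>H\<^esub>)"
  "f \<oplus>\<^bsub>hcopies n H\<^esub> g = (\<lambda>j. f j \<oplus>\<^bsub>H\<^esub> g j)"
  "c \<odot>\<^bsub>hcopies n H\<^esub> f = (\<lambda>j. c \<odot>\<^bsub>H\<^esub> f j)"
  "cinner (hcopies n H) f g = (\<Sum>j<n. cinner H (f j) (g j))"
  by (simp_all add: hcopies_def)

lemma (in complex_inner_space) complex_inner_space_hcopies: "complex_inner_space (hcopies n H)"
proof -
  have ab: "abelian_group (hcopies n H)"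
  proof (rule abelian_groupI)
    fix f assume f: "f \<in> carrier (hcopies n H)"
    show "\<exists>g\<in>carrier (hcopies n H). g \<oplus>\<^bsub>hcopies n H\<^esub> f = \<zero>\<^bsub>hcopies n H\<^esub>"
      using f by (intro bexI[of _ "\<lambda>j. \<ominus> f j"]) (simp_all add: M.l_neg)
  qed (auto simp: fun_eq_iff intro: M.a_assoc M.a_comm)
  have mod: "Module.module complex_field (hcopies n H)"
    by (rule moduleI) (simp_all add: ab cring_from_type_algebra smult_add_left smult_add_right
        smult_smult fun_eq_iff)
  have definite: "f = (\<lambda>j. \<zero>)"
    if f: "f \<in> carrier (hcopies n H)" and 0: "cinner (hcopies n H) f f = 0" for f
  proof
    fix j
    have "(\<Sum>j<n. Re (cinner H (f j) (f j))) = 0" using 0 by (simp flip: Re_sum)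
    then have "Re (cinner H (f j) (f j)) = 0" if "j < n"
      using f that by (subst (asm) sum_nonneg_eq_0_iff) (simp_all add: cinner_ge_zero)
    then show "f j = \<zero>"
      using f hnorm_eq_zero[of "f j"] by (cases "j < n") (auto simp: hnorm_def)
  qed
  show ?thesis
    using mod definite
    by (intro complex_inner_space.intro complex_inner_space_axioms.intro)
      (simp_all add: cinner_add_left cinner_smult_left sum.distrib sum_distrib_left sum_nonneg
        cinner_ge_zero cinner_commute[symmetric])
qed

lemma (in complex_inner_space) hnorm_hcopies_square:
  assumes "f \<in> carrier (hcopies n H)"
  shows "(hnorm (hcopies n H) f)\<^sup>2 = (\<Sum>j<n. (hnorm H (f j))\<^sup>2)"
proof -
  interpret K: complex_inner_space "hcopies n H" by (rule complex_inner_space_hcopies)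
  show ?thesis using assms by (simp add: K.hnorm_square hnorm_square)
qed

lemma (in complex_inner_space) minus_hcopies:
  assumes "f \<in> carrier (hcopies n H)" "g \<in> carrier (hcopies n H)"
  shows "f \<ominus>\<^bsub>hcopies n H\<^esub> g = (\<lambda>j. f j \<ominus> g j)"
proof -
  interpret K: complex_inner_space "hcopies n H" by (rule complex_inner_space_hcopies)
  show ?thesis using assms by (simp add: K.minus_eq_smult[OF assms] minus_eq_smult)
qed

text \<open>Each coordinate of a Cauchy sequence is Cauchy, and finitely many coordinate limits
  combine to a limit in norm.\<close>

lemma (in hilbert_space) hilbert_space_hcopies: "hilbert_space (hcopies n H)"
proof -
  interpret K: complex_inner_space "hcopies n H" by (rule complex_inner_space_hcopies)
  have dist: "(hdist (hcopies n H) f g)\<^sup>2 = (\<Sum>j<n. (hdist H (f j) (g j))\<^sup>2)"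
    if "f \<in> carrier (hcopies n H)" "g \<in> carrier (hcopies n H)" for f g
    using hnorm_hcopies_square[OF K.minus_closed'[OF that]]
    unfolding hdist_def by (simp only: minus_hcopies[OF that])
  show ?thesis
  proof (intro hilbert_space.intro complex_inner_space_hcopies hilbert_space_axioms.intro)
    fix s :: "nat \<Rightarrow> nat \<Rightarrow> 'a"
    assume s: "range s \<subseteq> carrier (hcopies n H)"
      and Cauchy: "\<forall>e>0. \<exists>N. \<forall>i\<ge>N. \<forall>k\<ge>N. hdist (hcopies n H) (s i) (s k) < e"
    have sc: "s i \<in> carrier (hcopies n H)" for i using s by blast
    then have sj: "s i j \<in> carrier H" for i j by simp
    have "\<exists>l\<in>carrier H. (\<lambda>i. hdist H (s i j) l) \<longlonglongrightarrow> 0" if j: "j < n" for j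
    proof (rule complete)
      show "range (\<lambda>i. s i j) \<subseteq> carrier H" using sj by blast
      have "hdist H (s i j) (s k j) \<le> hdist (hcopies n H) (s i) (s k)" for i k
      proof (rule power2_le_imp_le)
        show "(hdist H (s i j) (s k j))\<^sup>2 \<le> (hdist (hcopies n H) (s i) (s k))\<^sup>2"
          unfolding dist[OF sc sc] using j by (intro member_le_sum) simp_all
        show "0 \<le> hdist (hcopies n H) (s i) (s k)"
          unfolding hdist_def by (rule K.hnorm_ge_zero[OF K.minus_closed'[OF sc sc]])
      qed
      then show "\<forall>e>0. \<exists>N. \<forall>i\<ge>N. \<forall>k\<ge>N. hdist H (s i j) (s k j) < e"
        using Cauchy by (meson order_le_less_trans)
    qed
    then obtain L where L: "\<And>j. j < n \<Longrightarrow> L j \<in> carrier H"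
      and lim: "\<And>j. j < n \<Longrightarrow> (\<lambda>i. hdist H (s i j) (L j)) \<longlonglongrightarrow> 0"
      by metis
    define l where "l j = (if j < n then L j else \<zero>)" for j
    have l: "l \<in> carrier (hcopies n H)" using L by (simp add: l_def)
    have "(\<lambda>i. \<Sum>j<n. (hdist H (s i j) (l j))\<^sup>2) \<longlonglongrightarrow> (\<Sum>j<n. 0\<^sup>2)"
      using lim by (intro tendsto_sum tendsto_power) (simp add: l_def)
    then have "(\<lambda>i. sqrt ((hdist (hcopies n H) (s i) l)\<^sup>2)) \<longlonglongrightarrow> sqrt 0"
      unfolding dist[OF sc l] by (intro tendsto_real_sqrt) simp
    moreover have "0 \<le> hdist (hcopies n H) (s i) l" for i
      unfolding hdist_def by (rule K.hnorm_ge_zero[OF K.minus_closed'[OF sc l]])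
    ultimately show "\<exists>l\<in>carrier (hcopies n H). (\<lambda>i. hdist (hcopies n H) (s i) l) \<longlonglongrightarrow> 0"
      using l by (intro bexI[of _ l]) simp_all
  qed
qed

text \<open>One copy of a basis \<open>E\<close> in each slot gives a basis indexed by pairs of a
  slot and an element of \<open>E\<close>.\<close>

lemma (in complex_inner_space) dim_eq_times_hcopies: "dim_eq_times (hcopies n H) n H"
proof -
  interpret K: complex_inner_space "hcopies n H" by (rule complex_inner_space_hcopies)
  obtain E where E: "orthonormal_basis H E" using orthonormal_basis_exists by blast
  have Ec: "e \<in> carrier H" if "e \<in> E" for e
    using E that by (auto simp: orthonormal_basis_def orthonormal_def)
  have EE: "cinner H e e' = (if e = e' then 1 else 0)" if "e \<in> E" "e' \<in> E" for e e'
    using E that by (auto simp: orthonormal_basis_def orthonormal_def)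
  define \<iota> where "\<iota> = (\<lambda>(j :: nat, e) k. if k = j then e else \<zero>)"
  have \<iota>_carrier: "\<iota> (j, e) \<in> carrier (hcopies n H)" if "j < n" "e \<in> E" for j e
    using that Ec by (simp add: \<iota>_def)
  have cinner_\<iota>: "cinner (hcopies n H) f (\<iota> (j, e)) = cinner H (f j) e"
    if "f \<in> carrier (hcopies n H)" "j < n" for f j e
  proof -
    have "cinner (hcopies n H) f (\<iota> (j, e)) = (\<Sum>k<n. if k = j then cinner H (f j) e else 0)"
      unfolding hcopies_simps using that by (intro sum.cong) (simp_all add: \<iota>_def)
    then show ?thesis using that(2) by simp
  qed
  have inj: "inj_on \<iota> ({..<n} \<times> E)"
  proof (rule inj_onI, clarify)
    fix j e j' e' assume e: "e \<in> E" and e': "e' \<in> E" and eq: "\<iota> (j, e) = \<iota> (j', e')"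
    \<comment> \<open>Unit vectors are nonzero, so the slot \<open>j\<close> can be recovered from
      \<open>\<iota> (j, e)\<close>.\<close>
    have "e \<noteq> \<zero>" using EE[OF e e] by auto
    then show "j = j' \<and> e = e'"
      using fun_cong[OF eq, of j] by (auto simp: \<iota>_def split: if_splits)
  qed
  have "orthonormal_basis (hcopies n H) (\<iota> ` ({..<n} \<times> E))"
  proof (rule K.orthonormal_basisI)
    have "cinner (hcopies n H) (\<iota> p) (\<iota> q) = (if \<iota> p = \<iota> q then 1 else 0)"
      if p: "p \<in> {..<n} \<times> E" and q: "q \<in> {..<n} \<times> E" for p q
    proof -
      obtain j e j' e' where jj: "p = (j, e)" "q = (j', e')" "j < n" "j' < n" "e \<in> E" "e' \<in> E"
        using p q by auto
      have "\<iota> p = \<iota> q \<longleftrightarrow> p = q" using inj p q by (auto dest: inj_onD)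
      moreover have "cinner (hcopies n H) (\<iota> p) (\<iota> q) = cinner H (\<iota> p j') e'"
        using cinner_\<iota> \<iota>_carrier jj by simp
      ultimately show ?thesis using jj EE Ec by (auto simp: \<iota>_def)
    qed
    then show "orthonormal (hcopies n H) (\<iota> ` ({..<n} \<times> E))"
      using \<iota>_carrier unfolding orthonormal_def by blast
  next
    fix f assume f: "f \<in> carrier (hcopies n H)"
      and orth: "\<And>b. b \<in> \<iota> ` ({..<n} \<times> E) \<Longrightarrow> cinner (hcopies n H) f b = 0"
    have "f j = \<zero>" if j: "j < n" for j
    proof (rule orthonormal_basis_orthogonal[OF E])
      show "f j \<in> carrier H" using f by simp
      show "cinner H (f j) e = 0" if "e \<in> E" for e
        using orth[of "\<iota> (j, e)"] cinner_\<iota>[OF f j] j that by auto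
    qed
    then show "f = \<zero>\<^bsub>hcopies n H\<^esub>" using f by (simp add: fun_eq_iff) (meson not_less)
  qed
  moreover have "\<iota> ` ({..<n} \<times> E) \<approx> {..<n} \<times> E"
    using inj by (rule inj_on_image_eqpoll_self)
  ultimately show ?thesis using E unfolding dim_eq_times_def by blast
qed


section \<open>Dilations\<close>

definition spread :: "'a hilbert \<Rightarrow> nat \<Rightarrow> 'a \<Rightarrow> nat \<Rightarrow> 'a" where
  "spread H m x j = (if j < m then of_real (1 / sqrt m) \<odot>\<^bsub>H\<^esub> x else \<zero>\<^bsub>H\<^esub>)"

text \<open>\<open>g\<close> names the index that owns each slot, so one family of blocks
  \<open>B\<close> encodes all operators at once and distinct indices act on disjoint slots.\<close>

definition slot_operator ::
    "'a hilbert \<Rightarrow> nat \<Rightarrow> (nat \<Rightarrow> 'i) \<Rightarrow> (nat \<Rightarrow> 'a \<Rightarrow> 'a) \<Rightarrow> 'i \<Rightarrow> (nat \<Rightarrow> 'a) \<Rightarrow> nat \<Rightarrow> 'a" where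
  "slot_operator H m g B i f j = (if j < m \<and> g j = i then B j (f j) else \<zero>\<^bsub>H\<^esub>)"

context complex_inner_space
begin

lemma spread_in_carrier: "\<lbrakk>m \<le> n; x \<in> carrier H\<rbrakk> \<Longrightarrow> spread H m x \<in> carrier (hcopies n H)"
  by (simp add: spread_def)

lemma isometry_spread:
  assumes "0 < m" "m \<le> n"
  shows "isometry H (hcopies n H) (spread H m)"
proof -
  interpret K: complex_inner_space "hcopies n H" by (rule complex_inner_space_hcopies)
  have "hnorm (hcopies n H) (spread H m x) = hnorm H x" if x: "x \<in> carrier H" for x
  proof -
    have V: "spread H m x \<in> carrier (hcopies n H)" using assms(2) x by (rule spread_in_carrier)
    have "(hnorm (hcopies n H) (spread H m x))\<^sup>2 = (\<Sum>j<n. (hnorm H (spread H m x j))\<^sup>2)"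
      by (rule hnorm_hcopies_square[OF V])
    also have "\<dots> = (\<Sum>j<m. (hnorm H (spread H m x j))\<^sup>2)"
      using assms(2) by (intro sum.mono_neutral_right) (auto simp: spread_def)
    also have "\<dots> = (\<Sum>j<m. (hnorm H x)\<^sup>2 / m)"
      using x by (intro sum.cong)
        (simp_all add: spread_def hnorm_smult power_mult_distrib power_divide norm_divide)
    also have "\<dots> = (hnorm H x)\<^sup>2" using assms(1) by simp
    finally show ?thesis
      using K.hnorm_ge_zero[OF V] hnorm_ge_zero[OF x] by (simp add: power2_eq_iff_nonneg)
  qed
  moreover have "linear_map H (hcopies n H) (spread H m)"
    using assms(2) unfolding linear_map_def
    by (auto simp: spread_def smult_add_right smult_smult fun_eq_iff mult.commute)
  ultimately show ?thesis by (simp add: isometry_def)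
qed

lemma adjoint_pair_slot_operator:
  assumes "m \<le> n" and pair: "\<And>j. j < m \<Longrightarrow> adjoint_pair H (B j) (B' j)"
  shows "adjoint_pair (hcopies n H) (slot_operator H m g B i) (slot_operator H m g B' i)"
  using assms(1) adjoint_pairD[OF pair] unfolding adjoint_pair_def
  by (auto simp: slot_operator_def intro!: sum.cong)

text \<open>The slots are mutually orthogonal, so block bounds do not add up: squares are compared
  slot by slot, with \<open>0 \<le> c\<close> covering the slots where the operator is zero.\<close>

lemma hnorm_slot_operator_le:
  assumes "m \<le> n" and pair: "\<And>j. j < m \<Longrightarrow> adjoint_pair H (B j) (B' j)"
    and bound: "\<And>j x. \<lbrakk>j < m; x \<in> carrier H\<rbrakk> \<Longrightarrow> hnorm H (B j x) \<le> c * hnorm H x" and "0 \<le> c"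
    and f: "f \<in> carrier (hcopies n H)"
  shows "hnorm (hcopies n H) (slot_operator H m g B i f) \<le> c * hnorm (hcopies n H) f"
proof (rule power2_le_imp_le)
  interpret K: complex_inner_space "hcopies n H" by (rule complex_inner_space_hcopies)
  have T: "slot_operator H m g B i f \<in> carrier (hcopies n H)"
    using adjoint_pairD(1)[OF adjoint_pair_slot_operator[OF assms(1) pair] f] .
  have fj: "f j \<in> carrier H" for j using f by simp
  have "hnorm H (slot_operator H m g B i f j) \<le> c * hnorm H (f j)" for j
    using bound[OF _ fj] \<open>0 \<le> c\<close> fj by (simp add: slot_operator_def)
  moreover have "0 \<le> hnorm H (slot_operator H m g B i f j)" for j
    using T by (intro hnorm_ge_zero) simp
  ultimately have "(\<Sum>j<n. (hnorm H (slot_operator H m g B i f j))\<^sup>2) \<le> (\<Sum>j<n. (c * hnorm H (f j))\<^sup>2)"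
    by (intro sum_mono power_mono)
  then show "(hnorm (hcopies n H) (slot_operator H m g B i f))\<^sup>2 \<le> (c * hnorm (hcopies n H) f)\<^sup>2"
    unfolding power_mult_distrib hnorm_hcopies_square[OF T] hnorm_hcopies_square[OF f]
    by (simp add: sum_distrib_left)
  show "0 \<le> c * hnorm (hcopies n H) f"
    using \<open>0 \<le> c\<close> K.hnorm_ge_zero[OF f] by simp
qed

lemma commuting_slot_operators:
  assumes pair: "\<And>j. j < m \<Longrightarrow> adjoint_pair H (B j) (B' j)"
  shows "commuting_family (hcopies n H) I (slot_operator H m g B)"
proof -
  \<comment> \<open>For distinct indices each composite is, in slot \<open>j\<close>, either zero or
    \<open>B j \<zero>\<close>; commutation rests on these being equal.\<close>
  have "B j \<zero> = \<zero>" if "j < m" for j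
  proof -
    have "B j (0 \<odot> \<zero>) = 0 \<odot> B j \<zero>"
      using adjoint_pair_linear[OF pair[OF that]] unfolding linear_map_def by blast
    then show ?thesis using adjoint_pairD(1)[OF pair[OF that]] by simp
  qed
  then show ?thesis
    unfolding commuting_family_def by (auto simp: slot_operator_def fun_eq_iff)
qed

text \<open>\<open>A x\<close> is checked against the equation that defines the adjoint of
  \<open>spread\<close>. The hypothesis \<open>average\<close> is phrased through inner products, so
  that the sums are of complex numbers rather than of vectors.\<close>

lemma compression_slot_operator:
  assumes "0 < m" "m \<le> n" and pair: "\<And>j. j < m \<Longrightarrow> adjoint_pair H (B j) (B' j)"
    and A: "\<And>x. x \<in> carrier H \<Longrightarrow> A x \<in> carrier H"
    and average: "\<And>x z. \<lbrakk>x \<in> carrier H; z \<in> carrier H\<rbrakk> \<Longrightarrow>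
      (\<Sum>j | j < m \<and> g j = i. cinner H z (B j x)) = of_nat m * cinner H z (A x)"
  shows "compression_eq H (hcopies n H) (spread H m) (slot_operator H m g B i) A"
  unfolding compression_eq_def
proof
  fix x assume x: "x \<in> carrier H"
  have "cinner H z (A x)
      = cinner (hcopies n H) (spread H m z) (slot_operator H m g B i (spread H m x))"
    if z: "z \<in> carrier H" for z
  proof -
    define r :: complex where "r = of_real (1 / sqrt m)"
    have "1 / sqrt m * (1 / sqrt m) * real m = 1" using assms(1) by simp
    then have "r * r * complex_of_real (real m) = 1"
      unfolding r_def by (metis of_real_1 of_real_mult)
    then have r: "r * r * of_nat m = 1" "cnj r = r" "1 / complex_of_real (sqrt m) = r"
      by (simp_all add: r_def)
    have B: "B j (r \<odot> x) = r \<odot> B j x" "B j x \<in> carrier H" if "j < m" for j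
      using adjoint_pair_linear[OF pair[OF that]] x by (auto simp: linear_map_def)
    have "cinner (hcopies n H) (spread H m z) (slot_operator H m g B i (spread H m x))
        = (\<Sum>j | j < m \<and> g j = i. cinner H (r \<odot> z) (B j (r \<odot> x)))"
      unfolding hcopies_simps using assms(2) x z B
      by (intro sum.mono_neutral_cong_right)
        (auto simp: spread_def slot_operator_def r(3))
    \<comment> \<open>Each of the two occurrences of \<open>spread\<close> contributes one factor
      \<open>r\<close>; together they cancel the \<open>of_nat m\<close> supplied by
      \<open>average\<close>.\<close>
    also have "\<dots> = (\<Sum>j | j < m \<and> g j = i. (r * r) * cinner H z (B j x))"
      using B z by (intro sum.cong) (auto simp: cinner_smult_left cinner_smult_right r)
    also have "\<dots> = (r * r * of_nat m) * cinner H z (A x)"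
      by (simp only: sum_distrib_left[symmetric] average[OF x z] mult.assoc)
    finally show ?thesis
      using r by simp
  qed
  with A[OF x] show "A x = adj H (hcopies n H) (spread H m) (slot_operator H m g B i (spread H m x))"
    by (intro adj_eqI[symmetric])
qed

lemma slot_operator_bounded:
  assumes "m \<le> n" and pair: "\<And>j. j < m \<Longrightarrow> adjoint_pair H (B j) (B' j)"
    and bound: "\<And>j x. \<lbrakk>j < m; x \<in> carrier H\<rbrakk> \<Longrightarrow> hnorm H (B j x) \<le> c * hnorm H x" and "0 \<le> c"
  shows "bounded_operator (hcopies n H) (hcopies n H) (slot_operator H m g B i)"
    and "op_norm (hcopies n H) (hcopies n H) (slot_operator H m g B i) \<le> c"
proof -
  interpret K: complex_inner_space "hcopies n H" by (rule complex_inner_space_hcopies)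
  have le: "hnorm (hcopies n H) (slot_operator H m g B i f) \<le> c * hnorm (hcopies n H) f"
    if "f \<in> carrier (hcopies n H)" for f
    using assms that by (rule hnorm_slot_operator_le)
  have "linear_map (hcopies n H) (hcopies n H) (slot_operator H m g B i)"
    by (rule K.adjoint_pair_linear[OF adjoint_pair_slot_operator[OF assms(1) pair]])
  with le show "bounded_operator (hcopies n H) (hcopies n H) (slot_operator H m g B i)"
    unfolding bounded_operator_def by (intro conjI exI[of _ c] ballI)
  show "op_norm (hcopies n H) (hcopies n H) (slot_operator H m g B i) \<le> c"
    using le \<open>0 \<le> c\<close> by (rule K.op_norm_le)
qed

lemma adj_slot_operator:
  assumes "m \<le> n" and pair: "\<And>j. j < m \<Longrightarrow> adjoint_pair H (B j) (B' j)"
    and f: "f \<in> carrier (hcopies n H)"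
  shows "adj (hcopies n H) (hcopies n H) (slot_operator H m g B i) f = slot_operator H m g B' i f"
proof -
  interpret K: complex_inner_space "hcopies n H" by (rule complex_inner_space_hcopies)
  show ?thesis
    by (rule K.adjoint_pair_adj[OF adjoint_pair_slot_operator[OF assms(1) pair] f])
qed

end

section \<open>The self-adjoint and the normal dilation\<close>

lemma (in hilbert_space) contraction_adjoint_pair:
  assumes "contraction H A"
  shows "adjoint_pair H A (adj H H A)"
    and "x \<in> carrier H \<Longrightarrow> hnorm H (A x) \<le> hnorm H x"
    and "x \<in> carrier H \<Longrightarrow> hnorm H (adj H H A x) \<le> hnorm H x"
proof -
  show pair: "adjoint_pair H A (adj H H A)"
    using assms adjoint_pair_exists by (simp add: contraction_def)
  show "x \<in> carrier H \<Longrightarrow> hnorm H (A x) \<le> hnorm H x"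
    by (rule contraction_hnorm_le[OF assms])
  show "x \<in> carrier H \<Longrightarrow> hnorm H (adj H H A x) \<le> hnorm H x"
    using adjoint_pair_bound[OF pair, of 1 x] contraction_hnorm_le[OF assms] by simp
qed

lemma (in hilbert_space) selfadjoint_dilation:
  fixes A :: "nat \<Rightarrow> 'a \<Rightarrow> 'a"
  assumes d: "d \<ge> 1" and A: "\<And>i. i \<in> {1..d} \<Longrightarrow> contraction H (A i)"
    and sa: "\<And>i. i \<in> {1..d} \<Longrightarrow> selfadjoint_operator H (A i)"
  shows "has_selfadjoint_dilation d H A (real d)"
proof -
  define n :: nat where "n = 2 ^ (d - 1)"
  \<comment> \<open>This is \<open>k < 2 ^ k\<close> at \<open>k = d - 1\<close>, with
    \<open>d \<ge> 1\<close>.\<close>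
  have dn: "d \<le> n" using d less_exp[of "d - 1"] unfolding n_def by linarith
  \<comment> \<open>Slots count from 0 and operators from 1, so slot \<open>j\<close> belongs to
    \<open>A (Suc j)\<close>; the scalar undoes the weight 1/d of a single slot.\<close>
  define B where "B j x = of_nat d \<odot> A (Suc j) x" for j x
  have pairA: "adjoint_pair H (A i) (A i)" if "i \<in> {1..d}" for i
    using contraction_adjoint_pair(1)[OF A[OF that]] sa[OF that]
    by (simp add: adjoint_pair_def selfadjoint_operator_def)
  have pair: "adjoint_pair H (B j) (B j)" if "j < d" for j
    using adjoint_pair_smult[OF pairA[of "Suc j"], of "of_nat d"] that by (simp add: B_def[abs_def])
  have bound: "hnorm H (B j x) \<le> real d * hnorm H x" if "j < d" "x \<in> carrier H" for j x
    using contraction_adjoint_pair(2)[OF A[of "Suc j"]] adjoint_pairD(1)[OF pairA[of "Suc j"]] that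
    by (simp add: B_def hnorm_smult mult_left_mono)
  have average: "(\<Sum>j | j < d \<and> Suc j = i. cinner H z (B j x)) = of_nat d * cinner H z (A i x)"
    if "i \<in> {1..d}" "x \<in> carrier H" "z \<in> carrier H" for i x z
  proof -
    have "{j. j < d \<and> Suc j = i} = {i - 1}" using that by auto
    then show ?thesis
      using that adjoint_pairD(1)[OF pairA[OF that(1)]] by (simp add: B_def cinner_smult_right)
  qed
  have "compression_eq H (hcopies n H) (spread H d) (slot_operator H d Suc B i) (A i)"
    if "i \<in> {1..d}" for i
    using d dn pair adjoint_pairD(1)[OF pairA[OF that]] average[OF that]
    by (intro compression_slot_operator) simp_all
  moreover have "commuting_family (hcopies n H) {1..d} (slot_operator H d Suc B)"
    using pair by (rule commuting_slot_operators)
  moreover have "selfadjoint_operator (hcopies n H) (slot_operator H d Suc B i)" for i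
    unfolding selfadjoint_operator_def
  proof (intro conjI ballI)
    show "bounded_operator (hcopies n H) (hcopies n H) (slot_operator H d Suc B i)"
      using dn pair bound by (rule slot_operator_bounded(1)) simp_all
    fix f assume f: "f \<in> carrier (hcopies n H)"
    show "adj (hcopies n H) (hcopies n H) (slot_operator H d Suc B i) f = slot_operator H d Suc B i f"
      using dn pair f by (rule adj_slot_operator)
  qed
  moreover have "op_norm (hcopies n H) (hcopies n H) (slot_operator H d Suc B i) \<le> real d" for i
    using dn pair bound by (rule slot_operator_bounded(2)) simp_all
  moreover have "isometry H (hcopies n H) (spread H d)"
    using d dn by (intro isometry_spread) simp_all
  ultimately show ?thesis
    unfolding has_selfadjoint_dilation_def n_def[symmetric]
    using hilbert_space_hcopies dim_eq_times_hcopies by blast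
qed

lemma (in hilbert_space) normal_dilation:
  fixes A :: "nat \<Rightarrow> 'a \<Rightarrow> 'a"
  assumes d: "d \<ge> 1" and A: "\<And>i. i \<in> {1..d} \<Longrightarrow> contraction H (A i)"
  shows "has_normal_dilation d H A (2 * real d)"
proof -
  define n :: nat where "n = 2 ^ (2 * d - 1)"
  have dn: "2 * d \<le> n" using d less_exp[of "2 * d - 1"] unfolding n_def by linarith
  let ?A' = "\<lambda>i. adj H H (A i)"
  \<comment> \<open>Slots \<open>2 * k\<close> and \<open>2 * k + 1\<close> belong to operator
    \<open>Suc k\<close>.\<close>
  define g where "g j = Suc (j div 2)" for j :: nat
  have g: "g j \<in> {1..d}" if "j < 2 * d" for j using that by (auto simp: g_def)
  \<comment> \<open>The sign selects the self-adjoint block in even slots and the skew-adjoint one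
    in odd slots.\<close>
  define \<sigma> :: "nat \<Rightarrow> complex" where "\<sigma> j = (if even j then 1 else - 1)" for j
  define B where "B j x = of_nat d \<odot> (A (g j) x \<oplus> \<sigma> j \<odot> ?A' (g j) x)" for j x
  have pairA: "adjoint_pair H (A i) (?A' i)" if "i \<in> {1..d}" for i
    using contraction_adjoint_pair(1)[OF A[OF that]] .
  note Ac = adjoint_pairD(1,2)[OF pairA]
  \<comment> \<open>The adjoint of a block is the block itself up to sign, which is what makes it
    normal.\<close>
  define B' where "B' j x = \<sigma> j \<odot> B j x" for j x
  have \<sigma>: "\<sigma> j * \<sigma> j = 1" "cnj (\<sigma> j) = \<sigma> j" "cmod (\<sigma> j) = 1" for j by (simp_all add: \<sigma>_def)
  have Bc: "B j x \<in> carrier H" if "j < 2 * d" "x \<in> carrier H" for j x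
    using Ac[OF g] that by (simp add: B_def)
  have pair: "adjoint_pair H (B j) (B' j)" if j: "j < 2 * d" for j
  proof -
    have "adjoint_pair H (B j) (\<lambda>x. of_nat d \<odot> (?A' (g j) x \<oplus> \<sigma> j \<odot> A (g j) x))"
      using adjoint_pair_smult[OF adjoint_pair_add[OF pairA[OF g[OF j]]
          adjoint_pair_smult[OF adjoint_pair_swap[OF pairA[OF g[OF j]]], of "\<sigma> j"]], of "of_nat d"]
      by (simp add: B_def[abs_def] \<sigma>)
    moreover have "of_nat d \<odot> (?A' (g j) x \<oplus> \<sigma> j \<odot> A (g j) x) = B' j x" if "x \<in> carrier H" for x
      using Ac[OF g[OF j] that]
      by (simp add: B'_def B_def smult_smult smult_add_right mult.left_commute[of "\<sigma> j"] \<sigma> M.a_comm mult_ac)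
    ultimately show ?thesis by (simp add: adjoint_pair_def)
  qed
  have normal: "B' j (B j x) = B j (B' j x)" if "j < 2 * d" "x \<in> carrier H" for j x
    using adjoint_pair_linear[OF pair[OF that(1)]] Bc[OF that] by (simp add: B'_def linear_map_def)
  have bound: "hnorm H (B j x) \<le> (2 * real d) * hnorm H x" if j: "j < 2 * d" and x: "x \<in> carrier H" for j x
  proof -
    note c = Ac[OF g[OF j] x]
    have "hnorm H (A (g j) x \<oplus> \<sigma> j \<odot> ?A' (g j) x) \<le> hnorm H (A (g j) x) + hnorm H (?A' (g j) x)"
      using hnorm_triangle[OF c(1), of "\<sigma> j \<odot> ?A' (g j) x"] c by (simp add: hnorm_smult \<sigma>)
    also have "\<dots> \<le> 2 * hnorm H x"
      using contraction_adjoint_pair(2,3)[OF A[OF g[OF j]] x] by linarith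
    finally show ?thesis
      using c mult_left_mono[of "hnorm H (A (g j) x \<oplus> \<sigma> j \<odot> ?A' (g j) x)" "2 * hnorm H x" "real d"]
      by (simp add: B_def hnorm_smult mult_ac)
  qed
  have average: "(\<Sum>j | j < 2 * d \<and> g j = i. cinner H z (B j x)) = of_nat (2 * d) * cinner H z (A i x)"
    if i: "i \<in> {1..d}" and x: "x \<in> carrier H" and z: "z \<in> carrier H" for i x z
  proof -
    obtain k where k: "i = Suc k" "k < d" using i by (cases i) auto
    then have "{j. j < 2 * d \<and> g j = i} = {2 * k, 2 * k + 1}" by (auto simp: g_def)
    moreover have "g (2 * k) = i" "g (2 * k + 1) = i" using k by (simp_all add: g_def)
    ultimately show ?thesis
      \<comment> \<open>The two adjoint terms cancel and the two terms in \<open>A i x\<close> add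
        up, which with the scalar \<open>d\<close> gives \<open>2 * d\<close>.\<close>
      using Ac[OF i x] z
      by (simp add: B_def \<sigma>_def cinner_smult_right cinner_add_right algebra_simps)
  qed
  have "compression_eq H (hcopies n H) (spread H (2 * d)) (slot_operator H (2 * d) g B i) (A i)"
    if "i \<in> {1..d}" for i
    using d dn pair Ac(1)[OF that] average[OF that]
    by (intro compression_slot_operator) simp_all
  moreover have "normal_operator (hcopies n H) (slot_operator H (2 * d) g B i)" for i
    unfolding normal_operator_def
  proof (intro conjI ballI)
    show "bounded_operator (hcopies n H) (hcopies n H) (slot_operator H (2 * d) g B i)"
      using dn pair bound by (rule slot_operator_bounded(1)) simp_all
    fix f assume f: "f \<in> carrier (hcopies n H)"
    have adj: "adj (hcopies n H) (hcopies n H) (slot_operator H (2 * d) g B i) h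
        = slot_operator H (2 * d) g B' i h" if "h \<in> carrier (hcopies n H)" for h
      using dn pair that by (rule adj_slot_operator)
    have "adjoint_pair (hcopies n H) (slot_operator H (2 * d) g B i) (slot_operator H (2 * d) g B' i)"
      using dn pair by (rule adjoint_pair_slot_operator)
    then have Tf: "slot_operator H (2 * d) g B i f \<in> carrier (hcopies n H)"
      using f by (rule adjoint_pairD(1))
    show "adj (hcopies n H) (hcopies n H) (slot_operator H (2 * d) g B i) (slot_operator H (2 * d) g B i f)
        = slot_operator H (2 * d) g B i (adj (hcopies n H) (hcopies n H) (slot_operator H (2 * d) g B i) f)"
      \<comment> \<open>Both composites act block by block on the slots owned by \<open>i\<close>,
        so normality reduces to that of single blocks.\<close>
      unfolding adj[OF f] adj[OF Tf]
      using normal f by (auto simp: slot_operator_def fun_eq_iff)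
  qed
  moreover have "op_norm (hcopies n H) (hcopies n H) (slot_operator H (2 * d) g B i) \<le> 2 * real d" for i
    using dn pair bound by (rule slot_operator_bounded(2)) simp_all
  moreover have "dim_le_times (hcopies n H) n H"
    using dim_eq_times_hcopies[of n] unfolding dim_eq_times_def dim_le_times_def
    using eqpoll_imp_lepoll by blast
  moreover have "commuting_family (hcopies n H) {1..d} (slot_operator H (2 * d) g B)"
    using pair by (rule commuting_slot_operators)
  moreover have "isometry H (hcopies n H) (spread H (2 * d))"
    using d dn by (intro isometry_spread) simp_all
  ultimately show ?thesis
    unfolding has_normal_dilation_def n_def[symmetric]
    using hilbert_space_hcopies by blast
qed

lemma has_normal_dilation_mono:
  "\<lbrakk>has_normal_dilation d H A C; C \<le> C'\<rbrakk> \<Longrightarrow> has_normal_dilation d H A C'"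
  unfolding has_normal_dilation_def by (meson order_trans)

theorem theorem7p4:
  fixes d :: nat
  assumes "d \<ge> 1"
  shows
    "(\<exists>C. \<forall>(H :: 'a hilbert) A.
        hilbert_space H \<and> (\<forall>i\<in>{1..d}. contraction H (A i)) \<longrightarrow>
        has_normal_dilation d H A C) \<and>
     (\<forall>(H :: 'a hilbert) A.
        hilbert_space H \<and> (\<forall>i\<in>{1..d}. contraction H (A i)) \<longrightarrow>
        has_normal_dilation d H A (2 * sqrt 2 * real d)) \<and>
     (\<forall>(H :: 'a hilbert) A.
        hilbert_space H \<and>
        (\<forall>i\<in>{1..d}. contraction H (A i) \<and> selfadjoint_operator H (A i)) \<longrightarrow>
        has_selfadjoint_dilation d H A (real d))"
proof -
  have normal: "has_normal_dilation d H A (2 * real d)"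
    if "hilbert_space H" "\<forall>i\<in>{1..d}. contraction H (A i)" for H :: "'a hilbert" and A
    using hilbert_space.normal_dilation[OF that(1) assms] that(2) by blast
  have "2 * real d \<le> 2 * sqrt 2 * real d"
    by (intro mult_right_mono) simp_all
  then have "has_normal_dilation d H A (2 * sqrt 2 * real d)"
    if "hilbert_space H" "\<forall>i\<in>{1..d}. contraction H (A i)" for H :: "'a hilbert" and A
    using has_normal_dilation_mono[OF normal[OF that]] by blast
  moreover have "has_selfadjoint_dilation d H A (real d)"
    if "hilbert_space H" "\<forall>i\<in>{1..d}. contraction H (A i) \<and> selfadjoint_operator H (A i)"
    for H :: "'a hilbert" and A
    using hilbert_space.selfadjoint_dilation[OF that(1) assms] that(2) by blast
  \<comment> \<open>\<open>2 * sqrt 2 * real d\<close> depends on \<open>d\<close> alone, so it also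
    witnesses the uniform constant \<open>C\<close>.\<close>
  ultimately show ?thesis by blast
qed

end
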